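(* Let $l$ be a positive integer and let $T_0,T_1,\dots,T_l$ be simplicial trees. For each $n=0,\dots,l-1$, let $f_n:\mathcal V(T_{n+1})\to\mathcal V(T_n)$ be a simplicial map and let $g_n:\mathcal V(T_{n+1})\to\mathcal V(T_n)$ be a simplicial surjection, such that $f_{i-1}\circ g_i=g_{i-1}\circ f_i$ for all $i=1,\dots,l-1$, and such that $f_0$ and $g_0$ have no proximity vertices. Let $1>\varepsilon_0>\varepsilon_1>\dots>\varepsilon_l>0.5$ be real numbers. For $n=0,\dots,l$ and $v\in\mathcal V(T_n)$ set $$U_n^v=|g_{nl}|^{-1}\left(\operatorname{st}_{\varepsilon_n}(v,T_n)\right)\subseteq |T_l|,\qquad \mathcal U_n=\{U_n^v\mid v\in\mathcal V(T_n)\},$$ and for $n=0,\dots,l-1$ let $\varphi_n:\mathcal U_{n+1}\to\mathcal U_n$ be defined by $\varphi_n(U_{n+1}^v)=U_n^{f_n(v)}$. Then the following statements are true. (1) $\operatorname{cl}(U_j^w)\subseteq U_n^{g_{nj}(w)}$ for all $j=1,\dots,l$, all $n=0,\dots,j-1$, and all $w\in\mathcal V(T_j)$. (2) $w\in U_n^v\Leftrightarrow g_{nl}(w)=v$ for all $n=0,\dots,l$, $v\in\mathcal V(T_n)$ and $w\in\mathcal V(T_l)$. (3) For $j=0,\dots,l$, $n=0,\dots,j$, $u\in\mathcal V(T_j)$ and $v\in\mathcal V(T_n)$ consider the conditions: (a) $U_j^u\cap U_n^v\ne\emptyset$; (b) $\operatorname{cl}(U_j^u)\cap\operatorname{cl}(U_n^v)\neq\emptyset$;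 (c) there are vertices $w\in g_{jl}^{-1}(u)$ and $z\in g_{nl}^{-1}(v)$ which are $1$-close in $T_l$; (d) $g_{nj}(u)$ and $v$ are $1$-close in $T_n$. Then (a), (b) and (c) are equivalent and they imply (d), for all such $j,n,u,v$. If $j=n$, all four conditions are equivalent. (4) For all $n=0,\dots,l$ and any three distinct vertices $u,v,w\in\mathcal V(T_n)$, $U_n^u\cap U_n^v\cap U_n^w=\emptyset$. (5) For all $n=0,\dots,l$, $\mathcal U_n$ is an open cover of $|T_l|$, and the nerve of $\mathcal U_n$ is isomorphic to $T_n$, with the isomorphism established by $U_n^u\mapsto u$. (6) If $n\in\{0,\dots,l-1\}$, $u\in\mathcal V(T_n)$ and $v\in\mathcal V(T_{n+1})$ are such that $U_n^u\cap U_{n+1}^v\ne\emptyset$, then $\varphi_n(U_{n+1}^v)\cap U_n^u=\emptyset$. (7) Suppose $j\in\{2,\dots,l-1\}$, $n\in\{1,\dots,j\}$, $u\in\mathcal V(T_{j+1})$ and $v\in\mathcal V(T_{n+1})$. Then the following two implications are true: (a) $U_{j+1}^u\cap U_{n+1}^v\ne\emptyset\Rightarrow\varphi_j(U_{j+1}^u)\cap\varphi_n(U_{n+1}^v)\neq\emptyset$; (b) $U_{j+1}^u\subseteq U_{n+1}^v\Rightarrow\operatorname{cl}(\varphi_j(U_{j+1}^u))\subseteq\varphi_n(U_{n+1}^v)$. (8) If $n\in\{0,\dots,l-1\}$ and $u,v\in\mathcal V(T_{n+1})$ are such that $U_{n+1}^u\cap U_{n+1}^v\ne\emptyset$, then 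$\varphi_n(U_{n+1}^u)\cap\varphi_n(U_{n+1}^v)\neq\emptyset$.
   Context: A simplicial graph $G$ is a finite abstract simplicial complex of dimension at most one, with vertex set $\mathcal V(G)$ and edge set $\mathcal E(G)$ consisting of two-element sets $\{u,v\}$ of vertices. Two vertices belonging to an edge are adjacent. Vertices $v,v'$ are $k$-close in $G$ if there are vertices $v_0=v,v_1,\dots,v_k=v'$ such that for each $i=1,\dots,k$, $v_{i-1}$ and $v_i$ are equal or adjacent. Without loss of generality $\mathcal V(G)\subset\mathbb R^3$ is placed so that the segments $\langle u,v\rangle$, $\{u,v\}\in\mathcal E(G)$, contain no vertices except their endpoints and two distinct such segments can only meet in a common endpoint; the geometric realization $|G|$ is the union of $\mathcal V(G)$ and all these segments. $G$ is a simplicial tree if $|G|$ is a tree (connected union of finitely many arcs with no simple closed curve). A simplicial map from $G$ to $H$ is a function $f:\mathcal V(G)\to\mathcal V(H)$ taking every two adjacent vertices of $G$ either onto a pair of adjacent vertices of $H$ or onto a single vertex; it is a simplicial surjection if $f(\mathcal V(G))=\mathcal V(H)$. Its geometric realization $|f|:|G|\to|H|$ is equal to $f$ on vertices and is given by $|f|((1-t)u+tv)=(1-t)f(u)+tf(v)$ for $\{u,v\}\in\mathcal E(G)$, $t\in(0,1)$. For simplicial maps $f,g$ from $G$ to $H$, a vertex $v\in\mathcal V(G)$ is a proximity vertex for $f$ and $g$ if $f(v)$ and $g(v)$ are $2$-close in $H$. For $0\le i<j\le l$, $g_{ij}=g_i\circ g_{i+1}\circ\dots\circ g_{j-1}:\mathcal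 V(T_j)\to\mathcal V(T_i)$, and $g_{ii}$ is the identity. For $0<\varepsilon<1$, $v\in\mathcal V(G)$ and an edge $e=\{v,u\}$, $\operatorname{st}_\varepsilon(v,e)=\{(1-t)v+tu\mid 0\le t<\varepsilon\}$, and $\operatorname{st}_\varepsilon(v,G)$ is the union of $\{v\}$ and all $\operatorname{st}_\varepsilon(v,e)$ with $v\in e\in\mathcal E(G)$. Closures are taken in $|T_l|$. The nerve of a cover is the abstract simplicial complex whose vertices are the members of the cover, with a finite set of members forming a simplex when their intersection is nonempty.
   Formalization: In (7)(b) the range is n<j instead of n≤j: for n=j the premise forces u=v and the conclusion would make the nonempty proper open set U_j^{f_j(u)} closed in the connected space |T_l|, which is false. *)

theory Defs
  imports "HOL-Analysis.Analysis"
begin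

type_synonym point = "real ^ 3"

record sgraph =
  verts :: "point set"
  edges :: "point set set"

definition placed_sgraph :: "sgraph \<Rightarrow> bool" where
  "placed_sgraph G \<longleftrightarrow>
     finite (verts G) \<and>
     (\<forall>e\<in>edges G. e \<subseteq> verts G \<and> card e = 2) \<and>
     (\<forall>u v. {u, v} \<in> edges G \<longrightarrow> closed_segment u v \<inter> verts G = {u, v}) \<and>
     (\<forall>u v u' v'. {u, v} \<in> edges G \<and> {u', v'} \<in> edges G \<and> {u, v} \<noteq> {u', v'} \<longrightarrow>
        closed_segment u v \<inter> closed_segment u' v' \<subseteq> {u, v} \<inter> {u', v'})"

definition adjacent :: "sgraph \<Rightarrow> point \<Rightarrow> point \<Rightarrow> bool" where
  "adjacent G u v \<longleftrightarrow> {u, v} \<in> edges G"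

definition k_close :: "sgraph \<Rightarrow> nat \<Rightarrow> point \<Rightarrow> point \<Rightarrow> bool" where
  "k_close G k v v' \<longleftrightarrow>
     (\<exists>p :: nat \<Rightarrow> point. p 0 = v \<and> p k = v' \<and> (\<forall>i\<le>k. p i \<in> verts G) \<and>
        (\<forall>i\<in>{1..k}. p (i - 1) = p i \<or> adjacent G (p (i - 1)) (p i)))"

definition realization :: "sgraph \<Rightarrow> point set" where
  "realization G = verts G \<union> \<Union>{closed_segment u v | u v. {u, v} \<in> edges G}"

definition tree_space :: "point set \<Rightarrow> bool" where
  "tree_space X \<longleftrightarrow>
     X \<noteq> {} \<and> connected X \<and>
     (\<exists>\<A>. finite \<A> \<and> (\<forall>A\<in>\<A>. \<exists>p. arc p \<and> path_image p = A) \<and> X = \<Union>\<A>) \<and>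
     \<not> (\<exists>c. simple_path c \<and> pathfinish c = pathstart c \<and> path_image c \<subseteq> X)"

definition simplicial_tree :: "sgraph \<Rightarrow> bool" where
  "simplicial_tree G \<longleftrightarrow> placed_sgraph G \<and> tree_space (realization G)"

text \<open>A map \<open>\<V>(G) \<rightarrow> \<V>(H)\<close> is a total function on points of which only the
  values on \<open>\<V>(G)\<close> matter.\<close>

definition simplicial_map :: "sgraph \<Rightarrow> sgraph \<Rightarrow> (point \<Rightarrow> point) \<Rightarrow> bool" where
  "simplicial_map G H f \<longleftrightarrow>
     f ` verts G \<subseteq> verts H \<and>
     (\<forall>u v. adjacent G u v \<longrightarrow> adjacent H (f u) (f v) \<or> f u = f v)"

definition simplicial_surjection :: "sgraph \<Rightarrow> sgraph \<Rightarrow> (point \<Rightarrow> point) \<Rightarrow> bool" where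
  "simplicial_surjection G H f \<longleftrightarrow> simplicial_map G H f \<and> f ` verts G = verts H"

text \<open>The value is meaningful only on the realization of \<open>G\<close>; there the description below is
  unique, because a non-vertex point lies in exactly one open edge.\<close>

definition realization_map :: "sgraph \<Rightarrow> (point \<Rightarrow> point) \<Rightarrow> point \<Rightarrow> point" where
  "realization_map G f x =
     (if x \<in> verts G then f x
      else (THE y. \<exists>u v t. {u, v} \<in> edges G \<and> 0 < t \<and> t < 1 \<and>
              x = (1 - t) *\<^sub>R u + t *\<^sub>R v \<and> y = (1 - t) *\<^sub>R f u + t *\<^sub>R f v))"

definition proximity_vertex ::
    "sgraph \<Rightarrow> sgraph \<Rightarrow> (point \<Rightarrow> point) \<Rightarrow> (point \<Rightarrow> point) \<Rightarrow> point \<Rightarrow> bool" where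
  "proximity_vertex G H f g v \<longleftrightarrow> v \<in> verts G \<and> k_close H 2 (f v) (g v)"

text \<open>\<open>g i \<circ> g (i + 1) \<circ> \<dots> \<circ> g (j - 1)\<close>, the identity for \<open>i = j\<close>.\<close>

definition comp_range :: "(nat \<Rightarrow> point \<Rightarrow> point) \<Rightarrow> nat \<Rightarrow> nat \<Rightarrow> point \<Rightarrow> point" where
  "comp_range g i j = foldr (\<circ>) (map g [i..<j]) id"

definition star_edge :: "real \<Rightarrow> point \<Rightarrow> point \<Rightarrow> point set" where
  "star_edge \<epsilon> v u = {(1 - t) *\<^sub>R v + t *\<^sub>R u | t. 0 \<le> t \<and> t < \<epsilon>}"

definition star :: "real \<Rightarrow> point \<Rightarrow> sgraph \<Rightarrow> point set" where
  "star \<epsilon> v G = {v} \<union> \<Union>{star_edge \<epsilon> v u | u. {v, u} \<in> edges G}"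

definition cover_elem ::
    "(nat \<Rightarrow> sgraph) \<Rightarrow> (nat \<Rightarrow> point \<Rightarrow> point) \<Rightarrow> (nat \<Rightarrow> real) \<Rightarrow> nat \<Rightarrow> nat \<Rightarrow> point \<Rightarrow> point set"
  where
  "cover_elem T g \<epsilon> l n v =
     {x \<in> realization (T l).
        realization_map (T l) (comp_range g n l) x \<in> star (\<epsilon> n) v (T n)}"

definition cover_family ::
    "(nat \<Rightarrow> sgraph) \<Rightarrow> (nat \<Rightarrow> point \<Rightarrow> point) \<Rightarrow> (nat \<Rightarrow> real) \<Rightarrow> nat \<Rightarrow> nat \<Rightarrow> point set set"
  where
  "cover_family T g \<epsilon> l n = cover_elem T g \<epsilon> l n ` verts (T n)"

text \<open>The map between covers that sends the element of a vertex \<open>v\<close> of \<open>T (n + 1)\<close> to the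
  element of \<open>f n v\<close>. It is a function of the set \<open>W\<close>, so it first recovers the vertex indexing \<open>W\<close>;
  the intended equation therefore depends on distinct vertices having distinct cover elements.\<close>

definition cover_map ::
    "(nat \<Rightarrow> sgraph) \<Rightarrow> (nat \<Rightarrow> point \<Rightarrow> point) \<Rightarrow> (nat \<Rightarrow> point \<Rightarrow> point) \<Rightarrow> (nat \<Rightarrow> real) \<Rightarrow> nat \<Rightarrow>
     nat \<Rightarrow> point set \<Rightarrow> point set" where
  "cover_map T f g \<epsilon> l n W =
     cover_elem T g \<epsilon> l n
       (f n (THE v. v \<in> verts (T (n + 1)) \<and> cover_elem T g \<epsilon> l (n + 1) v = W))"

definition open_cover :: "point set \<Rightarrow> point set set \<Rightarrow> bool" where
  "open_cover X \<C> \<longleftrightarrow> (\<forall>W\<in>\<C>. openin (top_of_set X) W) \<and> \<Union>\<C> = X"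

text \<open>Simplices are nonempty; the vertex set of the complex is kept separate.\<close>

definition nerve :: "'a set set \<Rightarrow> 'a set set set" where
  "nerve \<C> = {S. S \<noteq> {} \<and> finite S \<and> S \<subseteq> \<C> \<and> \<Inter>S \<noteq> {}}"

definition graph_complex :: "sgraph \<Rightarrow> point set set" where
  "graph_complex G = {{v} | v. v \<in> verts G} \<union> edges G"

definition complex_isomorphism ::
    "'a set \<Rightarrow> 'a set set \<Rightarrow> 'b set \<Rightarrow> 'b set set \<Rightarrow> ('a \<Rightarrow> 'b) \<Rightarrow> bool" where
  "complex_isomorphism V K V' K' h \<longleftrightarrow>
     bij_betw h V V' \<and> (\<forall>S. S \<subseteq> V \<longrightarrow> (S \<in> K \<longleftrightarrow> h ` S \<in> K'))"

end

theory Submission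
  imports Defs
begin

text \<open>Barycentric coordinates turn the geometry into arithmetic. A point of a realization lies on a
  segment between two equal or adjacent vertices, and its coordinates depend only on the point. The
  realization of a simplicial map adds up coordinates over fibres, and a star of radius \<open>\<epsilon>\<close> about \<open>v\<close>
  consists of the points whose \<open>v\<close>-coordinate exceeds \<open>1 - \<epsilon>\<close>. Hence \<open>U n v\<close> is the set of points
  of the top tree at which the total weight of the vertices over \<open>v\<close>, a continuous function, exceeds
  \<open>1 - \<epsilon> n\<close> (\<open>U_eq\<close>), and the weight is still at least \<open>1 - \<epsilon> n\<close> on the closure.

  Most of the statement follows from this description. Weights only grow when fibres are enlarged and
  the radii strictly decrease with the level, so closures of higher elements lie inside lower ones.
  At most two vertices carry weight at a point, and they are equal or adjacent: this gives the empty
  triple intersections, and vertices one step apart over any two elements whose closures meet.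
  Conversely, the midpoint of an edge has weight \<open>1 / 2\<close> at both ends, which suffices because the radii
  exceed \<open>1 / 2\<close>; by the same bound the stars cover.

  The one place where trees matter is the converse at a single level: adjacent vertices of a lower
  tree must have adjacent preimages at the top (\<open>edge_lifts\<close>). If no edge lay over a given edge, the
  image of the connected top tree would join the two ends of that edge without using its interior,
  and this path together with the edge would contain a simple closed curve (\<open>tree_edge_separates\<close>).

  The statements about \<open>\<phi>\<close> are then combinatorial. Commutation lets \<open>f\<close> pass through compositions of
  the \<open>g\<close> (\<open>G_f\<close>), so adjacency and fibres are transported by \<open>f\<close>, and a proximity vertex at any level would
  be projected to one at the bottom (\<open>not_2_close\<close>). If \<open>U n u\<close> met both \<open>U (Suc n) v\<close> and its image
  \<open>U n (f n v)\<close>, then \<open>u\<close> would be within one step of both \<open>g n v\<close> and \<open>f n v\<close>.\<close>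

section \<open>Graphs and simplicial maps\<close>

definition linked :: "sgraph \<Rightarrow> point \<Rightarrow> point \<Rightarrow> bool" where
  "linked G a b \<longleftrightarrow> a \<in> verts G \<and> b \<in> verts G \<and> (a = b \<or> adjacent G a b)"

lemma k_close_1_iff: "k_close G 1 a b \<longleftrightarrow> linked G a b"
proof
  assume "k_close G 1 a b"
  then obtain p :: "nat \<Rightarrow> point" where "p 0 = a" "p 1 = b" "\<forall>i\<le>1. p i \<in> verts G"
    "\<forall>i\<in>{1..1}. p (i - 1) = p i \<or> adjacent G (p (i - 1)) (p i)"
    unfolding k_close_def by blast
  then show "linked G a b" unfolding linked_def by auto
next
  assume "linked G a b"
  then show "k_close G 1 a b"
    unfolding k_close_def linked_def
    by (intro exI[of _ "\<lambda>i. if i = 0 then a else b"]) auto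
qed

lemma linked_refl: "a \<in> verts G \<Longrightarrow> linked G a a"
  by (simp add: linked_def)

lemma linked_sym: "linked G a b \<Longrightarrow> linked G b a"
  by (auto simp: linked_def adjacent_def insert_commute)

lemma linked_trans_k_close_2:
  assumes "linked G a b" "linked G b c"
  shows "k_close G 2 a c"
proof -
  define p :: "nat \<Rightarrow> point" where "p i = (if i = 0 then a else if i = 1 then b else c)" for i
  have "{1..2::nat} = {1, 2}" by auto
  with assms show ?thesis
    unfolding k_close_def linked_def by (intro exI[of _ p]) (auto simp: p_def)
qed

lemma k_close_image:
  assumes "simplicial_map G H F" "k_close G k a b"
  shows "k_close H k (F a) (F b)"
proof -
  obtain p :: "nat \<Rightarrow> point" where p: "p 0 = a" "p k = b" "\<forall>i\<le>k. p i \<in> verts G"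
    "\<forall>i\<in>{1..k}. p (i - 1) = p i \<or> adjacent G (p (i - 1)) (p i)"
    using assms(2) unfolding k_close_def by blast
  show ?thesis unfolding k_close_def
  proof (intro exI[of _ "F \<circ> p"] conjI allI impI ballI)
    show "(F \<circ> p) i \<in> verts H" if "i \<le> k" for i
      using that p(3) assms(1) unfolding simplicial_map_def by auto
    show "(F \<circ> p) (i - 1) = (F \<circ> p) i \<or> adjacent H ((F \<circ> p) (i - 1)) ((F \<circ> p) i)"
      if "i \<in> {1..k}" for i
      using that p(4) assms(1) unfolding simplicial_map_def by (metis comp_apply)
  qed (use p in auto)
qed

lemma linked_image: "simplicial_map G H F \<Longrightarrow> linked G a b \<Longrightarrow> linked H (F a) (F b)"
  using k_close_image[of G H F 1 a b] by (simp only: k_close_1_iff)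

lemma simplicial_surjection_id: "simplicial_surjection G G id"
  by (auto simp: simplicial_surjection_def simplicial_map_def)

lemma simplicial_surjection_comp:
  assumes "simplicial_surjection G H F" "simplicial_surjection H K F'"
  shows "simplicial_surjection G K (F' \<circ> F)"
  using assms unfolding simplicial_surjection_def simplicial_map_def image_comp[symmetric]
  by (metis comp_apply)

lemma placed_edge:
  assumes "placed_sgraph G" "{u, v} \<in> edges G"
  shows "u \<in> verts G" "v \<in> verts G" "u \<noteq> v"
  using assms unfolding placed_sgraph_def by fastforce+

lemma placed_edgeE:
  assumes "placed_sgraph G" "e \<in> edges G"
  obtains u v where "e = {u, v}" "u \<noteq> v" "u \<in> verts G" "v \<in> verts G"
  using assms placed_edge[OF assms(1)] unfolding placed_sgraph_def by (metis card_2_iff)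

lemma finite_linked: "placed_sgraph G \<Longrightarrow> finite {(a, b). linked G a b}"
  by (rule finite_subset[of _ "verts G \<times> verts G"]) (auto simp: linked_def placed_sgraph_def)

section \<open>Barycentric coordinates\<close>

definition bary :: "'a \<Rightarrow> 'a \<Rightarrow> real \<Rightarrow> 'a \<Rightarrow> real" where
  "bary a b s v = (if v = a then 1 - s else 0) + (if v = b then s else 0)"

text \<open>Linked vertices may coincide, so that vertices and edge points are described uniformly.\<close>

definition position :: "sgraph \<Rightarrow> point \<Rightarrow> point \<Rightarrow> point \<Rightarrow> real \<Rightarrow> bool" where
  "position G x a b s \<longleftrightarrow> linked G a b \<and> 0 \<le> s \<and> s \<le> 1 \<and> x = (1 - s) *\<^sub>R a + s *\<^sub>R b"

lemma realization_eq_Union_linked: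
  assumes "placed_sgraph G"
  shows "realization G = (\<Union>(a, b)\<in>{(a, b). linked G a b}. closed_segment a b)"
  using placed_edge[OF assms]
  by (fastforce simp: realization_def linked_def adjacent_def)

lemma position_exists:
  assumes "placed_sgraph G" "x \<in> realization G"
  obtains a b s where "position G x a b s"
  using assms(2) unfolding realization_eq_Union_linked[OF assms(1)]
  by (auto simp: position_def in_segment)

lemma position_in_realization:
  assumes "placed_sgraph G" "position G x a b s"
  shows "x \<in> realization G"
  using assms(2) unfolding realization_eq_Union_linked[OF assms(1)] position_def
  by (auto simp: in_segment)

lemma position_vertex: "v \<in> verts G \<Longrightarrow> position G v v v 0"
  by (simp add: position_def linked_refl)

lemma affine_combination_unique:
  fixes a b :: "'a :: real_vector"
  assumes "(1 - s) *\<^sub>R a + s *\<^sub>R b = (1 - t) *\<^sub>R a + t *\<^sub>R b" "a \<noteq> b"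
  shows "s = t"
proof -
  have "(s - t) *\<^sub>R (b - a) = 0" using assms(1) by (simp add: algebra_simps)
  then show ?thesis using assms(2) by simp
qed

lemma bary_at_vertex:
  assumes "placed_sgraph G" "position G x a b s" "x \<in> verts G"
  shows "bary a b s = bary x x 0"
proof (cases "a = b")
  case True
  then have "x = a" using assms(2) by (simp add: position_def algebra_simps)
  then show ?thesis using True by (auto simp: bary_def)
next
  case False
  have x: "x = (1 - s) *\<^sub>R a + s *\<^sub>R b" "{a, b} \<in> edges G" "x \<in> closed_segment a b"
    using assms(2) False by (auto simp: position_def linked_def adjacent_def in_segment)
  then have "x = a \<or> x = b" using assms(1,3) unfolding placed_sgraph_def by blast
  then show ?thesis
  proof
    assume "x = a"
    then have "s = 0" using affine_combination_unique[of s a b 0] x(1) False by simp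
    then show ?thesis using \<open>x = a\<close> False by (auto simp: bary_def)
  next
    assume "x = b"
    then have "s = 1" using affine_combination_unique[of s a b 1] x(1) False by simp
    then show ?thesis using \<open>x = b\<close> False by (auto simp: bary_def)
  qed
qed

text \<open>Two positions of a non-vertex point lie on the same edge, because distinct edges meet only in
  vertices; they can differ only by exchanging the endpoints and \<open>s\<close> with \<open>1 - s\<close>.\<close>

lemma bary_unique:
  assumes G: "placed_sgraph G" and p: "position G x a b s" and q: "position G x c d t"
  shows "bary a b s = bary c d t"
proof (cases "x \<in> verts G")
  case True
  then show ?thesis using bary_at_vertex[OF G p] bary_at_vertex[OF G q] by simp
next
  case False
  have ends: "y \<noteq> z" if "position G x y z r" for y z r
    using that False by (auto simp: position_def linked_def algebra_simps)
  have ab: "a \<noteq> b" "{a, b} \<in> edges G" "x \<in> closed_segment a b" "x = (1 - s) *\<^sub>R a + s *\<^sub>R b"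
    using p ends[OF p] by (auto simp: position_def linked_def adjacent_def in_segment)
  have cd: "c \<noteq> d" "{c, d} \<in> edges G" "x \<in> closed_segment c d" "x = (1 - t) *\<^sub>R c + t *\<^sub>R d"
    using q ends[OF q] by (auto simp: position_def linked_def adjacent_def in_segment)
  have "{a, b} = {c, d}"
  proof (rule ccontr)
    assume "{a, b} \<noteq> {c, d}"
    then have "closed_segment a b \<inter> closed_segment c d \<subseteq> {a, b} \<inter> {c, d}"
      using G ab(2) cd(2) unfolding placed_sgraph_def by blast
    then have "x \<in> {a, b}" using ab(3) cd(3) by blast
    then show False using False placed_edge[OF G ab(2)] by auto
  qed
  then consider "a = c" "b = d" | "a = d" "b = c" using ab(1) by (auto simp: doubleton_eq_iff)
  then show ?thesis
  proof cases
    case 1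
    have "x = (1 - t) *\<^sub>R a + t *\<^sub>R b" unfolding cd(4) 1 ..
    then have "(1 - s) *\<^sub>R a + s *\<^sub>R b = (1 - t) *\<^sub>R a + t *\<^sub>R b"
      by (subst (asm) ab(4))
    from affine_combination_unique[OF this ab(1)] show ?thesis using 1 by simp
  next
    case 2
    have "x = (1 - (1 - t)) *\<^sub>R a + (1 - t) *\<^sub>R b"
      unfolding cd(4) 2 by (simp add: add.commute)
    then have "(1 - s) *\<^sub>R a + s *\<^sub>R b = (1 - (1 - t)) *\<^sub>R a + (1 - t) *\<^sub>R b"
      by (subst (asm) ab(4))
    then have "s = 1 - t" by (rule affine_combination_unique[OF _ ab(1)])
    then show ?thesis using 2 ab(1) by (auto simp: bary_def)
  qed
qed

definition coord :: "sgraph \<Rightarrow> point \<Rightarrow> point \<Rightarrow> real" where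
  "coord G x = (SOME c. \<exists>a b s. position G x a b s \<and> c = bary a b s)"

lemma coord_eq:
  assumes "placed_sgraph G" "position G x a b s"
  shows "coord G x = bary a b s"
  unfolding coord_def
  by (rule some_equality) (use assms bary_unique in blast)+

text \<open>The realization is a finite union of closed segments, on each of which a coordinate is an affine
  function of the parameter.\<close>

lemma continuous_on_coord:
  assumes G: "placed_sgraph G"
  shows "continuous_on (realization G) (\<lambda>x. coord G x v)"
  unfolding realization_eq_Union_linked[OF G]
proof (rule continuous_on_closed_Union, goal_cases)
  case 1
  show ?case by (rule finite_linked[OF G])
next
  case (2 ab)
  then show ?case by (auto simp: case_prod_beta)
next
  case (3 ab)
  then obtain a b where ab: "ab = (a, b)" "linked G a b" by auto
  show ?case
  proof (cases "a = b")
    case True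
    then show ?thesis using ab by simp
  next
    case False
    \<comment> \<open>the parameter of a point of a segment is its relative distance from the endpoint\<close>
    define s where "s x = dist a x / dist a b" for x
    have "coord G x v = bary a b (s x) v" if x: "x \<in> closed_segment a b" for x
    proof -
      obtain t where t: "0 \<le> t" "t \<le> 1" "x = (1 - t) *\<^sub>R a + t *\<^sub>R b"
        using x by (auto simp: in_segment)
      have "a - x = t *\<^sub>R (a - b)" by (simp add: t algebra_simps)
      then have "s x = t" using t False by (simp add: s_def dist_norm)
      then show ?thesis using coord_eq[OF G, of x a b t] t ab by (simp add: position_def)
    qed
    moreover have "continuous_on (closed_segment a b) (\<lambda>x. bary a b (s x) v)"
      unfolding s_def bary_def using False
      by (cases "v = a"; cases "v = b") (auto intro!: continuous_intros)
    ultimately show ?thesis using ab by (simp cong: continuous_on_cong)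
  qed
qed

text \<open>Equality for any two positions of \<open>x\<close> holds because the right-hand side is the combination
  of all the \<open>F v\<close> with the barycentric coordinates of \<open>x\<close> as coefficients.\<close>

lemma realization_map_position:
  assumes G: "placed_sgraph G" and p: "position G x a b s"
  shows "realization_map G F x = (1 - s) *\<^sub>R F a + s *\<^sub>R F b"
proof -
  have combine: "(1 - s) *\<^sub>R F a + s *\<^sub>R F b = (1 - t) *\<^sub>R F c + t *\<^sub>R F d"
    if q: "position G x c d t" for c d t
  proof -
    have sum: "(\<Sum>v\<in>verts G. bary a b s v *\<^sub>R F v) = (1 - s) *\<^sub>R F a + s *\<^sub>R F b"
      if "position G x a b s" for a b s
      using that G
      by (simp add: position_def linked_def bary_def scaleR_add_left sum.distrib placed_sgraph_def
          if_distrib[of "\<lambda>r. r *\<^sub>R _"] sum.delta cong: if_cong)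
    show ?thesis
      using sum[OF p] sum[OF q] by (simp add: bary_unique[OF G p q])
  qed
  show ?thesis
  proof (cases "x \<in> verts G")
    case True
    then show ?thesis
      using combine[OF position_vertex[OF True]] by (simp add: realization_map_def)
  next
    case False
    have "s \<noteq> 0" "s \<noteq> 1" "a \<noteq> b"
      using False p by (auto simp: position_def linked_def algebra_simps)
    then have ab: "{a, b} \<in> edges G" "0 < s" "s < 1" "x = (1 - s) *\<^sub>R a + s *\<^sub>R b"
      using p by (auto simp: position_def linked_def adjacent_def)
    show ?thesis unfolding realization_map_def if_not_P[OF False]
    proof (rule the_equality)
      show "\<exists>u v t. {u, v} \<in> edges G \<and> 0 < t \<and> t < 1 \<and> x = (1 - t) *\<^sub>R u + t *\<^sub>R v \<and>
        (1 - s) *\<^sub>R F a + s *\<^sub>R F b = (1 - t) *\<^sub>R F u + t *\<^sub>R F v"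
        using ab by blast
    next
      fix y
      assume "\<exists>u v t. {u, v} \<in> edges G \<and> 0 < t \<and> t < 1 \<and> x = (1 - t) *\<^sub>R u + t *\<^sub>R v \<and>
        y = (1 - t) *\<^sub>R F u + t *\<^sub>R F v"
      then obtain u v t where uv: "{u, v} \<in> edges G" "0 < t" "t < 1"
        "x = (1 - t) *\<^sub>R u + t *\<^sub>R v" "y = (1 - t) *\<^sub>R F u + t *\<^sub>R F v"
        by blast
      have "position G x u v t"
        using uv placed_edge[OF G uv(1)] by (auto simp: position_def linked_def adjacent_def)
      from combine[OF this] show "y = (1 - s) *\<^sub>R F a + s *\<^sub>R F b" using uv(5) by simp
    qed
  qed
qed

lemma star_iff_bary:
  assumes G: "placed_sgraph G" and v: "v \<in> verts G" and \<epsilon>: "0 < \<epsilon>" "\<epsilon> < 1"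
    and p: "position G x a b s"
  shows "x \<in> star \<epsilon> v G \<longleftrightarrow> 1 - \<epsilon> < bary a b s v"
proof
  assume "x \<in> star \<epsilon> v G"
  then consider "x = v"
    | u t where "{v, u} \<in> edges G" "0 \<le> t" "t < \<epsilon>" "x = (1 - t) *\<^sub>R v + t *\<^sub>R u"
    unfolding star_def star_edge_def by blast
  then show "1 - \<epsilon> < bary a b s v"
  proof cases
    case 1
    then show ?thesis using bary_at_vertex[OF G p] v \<epsilon> by (simp add: bary_def)
  next
    case 2
    then have "position G x v u t"
      using \<epsilon> placed_edge[OF G 2(1)] by (auto simp: position_def linked_def adjacent_def)
    from bary_unique[OF G p this] show ?thesis using 2 \<epsilon> by (simp add: bary_def)
  qed
next
  assume *: "1 - \<epsilon> < bary a b s v"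
  have pos: "linked G a b" "0 \<le> s" "s \<le> 1" "x = (1 - s) *\<^sub>R a + s *\<^sub>R b"
    using p by (auto simp: position_def)
  consider "v = a" "v = b" | "v = a" "v \<noteq> b" | "v = b" "v \<noteq> a"
    using * \<epsilon> by (fastforce simp: bary_def)
  then show "x \<in> star \<epsilon> v G"
  proof cases
    case 1
    then have "x = v" using pos by (simp add: algebra_simps)
    then show ?thesis by (simp add: star_def)
  next
    case 2
    then have "x \<in> star_edge \<epsilon> v b" "{v, b} \<in> edges G"
      using * pos by (auto simp: star_edge_def bary_def linked_def adjacent_def)
    then show ?thesis by (auto simp: star_def)
  next
    case 3
    then have "1 - s < \<epsilon>" using * by (simp add: bary_def)
    then have "x \<in> star_edge \<epsilon> v a" unfolding star_edge_def
      using 3 pos by (intro CollectI exI[of _ "1 - s"]) (auto simp: add.commute)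
    moreover have "{v, a} \<in> edges G"
      using 3 pos by (auto simp: linked_def adjacent_def insert_commute)
    ultimately show ?thesis by (auto simp: star_def)
  qed
qed

text \<open>This is the \<open>v\<close>-coordinate of the image of \<open>x\<close> under the realization of a simplicial map \<open>F\<close>. Written as
  a sum over a fibre it is visibly continuous in \<open>x\<close> and monotone in the fibre.\<close>

definition fibre_mass :: "sgraph \<Rightarrow> (point \<Rightarrow> point) \<Rightarrow> point \<Rightarrow> point \<Rightarrow> real" where
  "fibre_mass G F v x = (\<Sum>w | w \<in> verts G \<and> F w = v. coord G x w)"

lemma fibre_mass_position:
  assumes G: "placed_sgraph G" and p: "position G x a b s"
  shows "fibre_mass G F v x = bary (F a) (F b) s v"
proof -
  have "finite (verts G)" "a \<in> verts G" "b \<in> verts G"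
    using assms by (auto simp: placed_sgraph_def position_def linked_def)
  then have "(\<Sum>w | w \<in> verts G \<and> F w = v. bary a b s w) = bary (F a) (F b) s v"
    by (simp add: bary_def sum.distrib sum.delta eq_commute[of v])
  then show ?thesis by (simp only: fibre_mass_def coord_eq[OF G p])
qed

lemma continuous_on_fibre_mass:
  "placed_sgraph G \<Longrightarrow> continuous_on (realization G) (fibre_mass G F v)"
  unfolding fibre_mass_def by (intro continuous_on_sum continuous_on_coord)

lemma fibre_mass_vertex:
  assumes "placed_sgraph G" "w \<in> verts G"
  shows "fibre_mass G F v w = (if F w = v then 1 else 0)"
  using fibre_mass_position[OF assms(1) position_vertex[OF assms(2)]] by (auto simp: bary_def)

lemma fibre_mass_compose_le:
  assumes G: "placed_sgraph G" and x: "x \<in> realization G"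
  shows "fibre_mass G F v x \<le> fibre_mass G (H \<circ> F) (H v) x"
proof -
  obtain a b s where p: "position G x a b s" using position_exists[OF G x] .
  then have "0 \<le> s" "s \<le> 1" by (auto simp: position_def)
  then show ?thesis by (auto simp: fibre_mass_position[OF G p] bary_def)
qed

lemma preimage_star_eq:
  assumes G: "placed_sgraph G" and H: "placed_sgraph H" and F: "simplicial_map G H F"
    and v: "v \<in> verts H" and \<epsilon>: "0 < \<epsilon>" "\<epsilon> < 1" and x: "x \<in> realization G"
  shows "realization_map G F x \<in> star \<epsilon> v H \<longleftrightarrow> 1 - \<epsilon> < fibre_mass G F v x"
proof -
  obtain a b s where p: "position G x a b s" using position_exists[OF G x] .
  have "position H (realization_map G F x) (F a) (F b) s"
    using p linked_image[OF F] unfolding realization_map_position[OF G p] position_def by blast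
  from star_iff_bary[OF H v \<epsilon> this] show ?thesis by (simp add: fibre_mass_position[OF G p])
qed

section \<open>Edges of a tree lift along simplicial surjections\<close>

text \<open>The segments that start in \<open>A\<close> and those that start outside \<open>A\<close> form two closed sets covering the
  realization. They are disjoint, since a common point would have positive coordinates at vertices both
  inside and outside \<open>A\<close>.\<close>

lemma adjacency_closed_eq_verts:
  assumes G: "placed_sgraph G" and conn: "connected (realization G)"
    and A: "A \<subseteq> verts G" "A \<noteq> {}" and step: "\<And>p q. adjacent G p q \<Longrightarrow> p \<in> A \<Longrightarrow> q \<in> A"
  shows "A = verts G"
proof (rule ccontr)
  assume "A \<noteq> verts G"
  define R where "R B = (\<Union>(a, b)\<in>{(a, b). linked G a b \<and> a \<in> B}. closed_segment a b)" for B
  have cl: "closed (R B)" for B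
    unfolding R_def
    by (intro closed_UN finite_subset[OF _ finite_linked[OF G]]) (auto simp: case_prod_beta)
  have sub: "B \<inter> verts G \<subseteq> R B" for B
    by (force simp: R_def linked_def)
  have stay: "b \<in> A \<longleftrightarrow> a \<in> A" if "linked G a b" for a b
    using that linked_sym[OF that] step unfolding linked_def by metis
  have "R A \<inter> R (verts G - A) = {}"
  proof (rule ccontr)
    assume "R A \<inter> R (verts G - A) \<noteq> {}"
    then obtain x a b c d where "linked G a b" "a \<in> A" "x \<in> closed_segment a b"
      "linked G c d" "c \<notin> A" "x \<in> closed_segment c d"
      by (auto simp: R_def)
    then obtain s t where p: "position G x a b s" and q: "position G x c d t"
      by (auto simp: position_def in_segment)
    have "b \<in> A" "d \<notin> A" using stay \<open>linked G a b\<close> \<open>linked G c d\<close> \<open>a \<in> A\<close> \<open>c \<notin> A\<close> by auto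
    then have "bary c d t a = 0" "bary c d t b = 0"
      using \<open>a \<in> A\<close> \<open>c \<notin> A\<close> by (auto simp: bary_def)
    moreover have "bary a b s a \<noteq> 0 \<or> bary a b s b \<noteq> 0" by (auto simp: bary_def)
    ultimately show False using bary_unique[OF G p q] by simp
  qed
  moreover have "realization G = R A \<union> R (verts G - A)"
    unfolding realization_eq_Union_linked[OF G] R_def using stay
    by (auto simp: linked_def) blast+
  ultimately show False
    using conn cl[of A] cl[of "verts G - A"] sub[of A] sub[of "verts G - A"] A \<open>A \<noteq> verts G\<close>
    unfolding connected_closed
    by (metis Diff_eq_empty_iff Int_absorb2 Int_commute Un_upper1 Un_upper2 inf.absorb_iff2 order_refl
        subset_antisym subset_empty Diff_subset)
qed

text \<open>An arc between the endpoints that avoids the open segment closes up with that segment to a simple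
  closed curve.\<close>

lemma tree_edge_separates:
  assumes tree: "simplicial_tree H" and uv: "adjacent H u v"
  shows "\<not> path_component (realization H - open_segment u v) u v"
proof
  assume "path_component (realization H - open_segment u v) u v"
  then obtain p where p: "path p" "path_image p \<subseteq> realization H - open_segment u v"
    "pathstart p = u" "pathfinish p = v"
    unfolding path_component_def by blast
  have H: "placed_sgraph H" using tree by (simp add: simplicial_tree_def)
  have "u \<noteq> v" using placed_edge[OF H] uv by (auto simp: adjacent_def)
  then obtain q where q: "arc q" "path_image q \<subseteq> path_image p" "pathstart q = u" "pathfinish q = v"
    using path_contains_arc[OF p(1,3,4)] by metis
  have "path_image q \<inter> closed_segment v u \<subseteq> {u, v}"
    using q(2) p(2) by (auto simp: open_segment_def closed_segment_commute)
  then have "simple_path (q +++ linepath v u)"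
    using q \<open>u \<noteq> v\<close> by (intro simple_path_join_loop) auto
  moreover have "path_image (q +++ linepath v u) \<subseteq> realization H"
  proof -
    have "closed_segment v u \<subseteq> realization H"
      using uv by (auto simp: realization_def adjacent_def closed_segment_commute)
    then show ?thesis using q p(2) by (auto simp: path_image_join)
  qed
  ultimately show False
    using tree q unfolding simplicial_tree_def tree_space_def
    by (metis pathfinish_join pathfinish_linepath pathstart_join)
qed

text \<open>Suppose that no edge maps onto \<open>{u, v}\<close>. Then every edge maps to a vertex or to a segment that
  avoids the open segment between \<open>u\<close> and \<open>v\<close>, so adjacent vertices have images in the same path component of the
  complement. By connectedness \<open>u\<close> and \<open>v\<close> are then in one such component, although the edge
  separates them.\<close>

lemma edge_lifts:
  assumes G: "placed_sgraph G" "connected (realization G)" and H: "simplicial_tree H"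
    and F: "simplicial_surjection G H F" and uv: "adjacent H u v"
  obtains p q where "adjacent G p q" "F p = u" "F q = v"
proof (rule ccontr)
  assume "\<not> thesis"
  with that have no: "\<not> (adjacent G p q \<and> F p = u \<and> F q = v)" for p q by blast
  have map: "simplicial_map G H F" and onto: "F ` verts G = verts H"
    using F by (auto simp: simplicial_surjection_def)
  have H': "placed_sgraph H" using H by (simp add: simplicial_tree_def)
  have uv': "u \<in> verts H" "v \<in> verts H" using placed_edge[OF H'] uv by (auto simp: adjacent_def)
  define S where "S = realization H - open_segment u v"
  have seg: "closed_segment a b \<subseteq> S" if "adjacent H a b" "{a, b} \<noteq> {u, v}" for a b
  proof -
    have "closed_segment a b \<inter> closed_segment u v \<subseteq> {a, b} \<inter> {u, v}"
      using H' that uv unfolding placed_sgraph_def adjacent_def by blast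
    then show ?thesis
      using that(1) unfolding S_def open_segment_def realization_def adjacent_def by blast
  qed
  define A where "A = {p \<in> verts G. path_component S u (F p)}"
  have "u \<in> S" using uv' by (auto simp: S_def realization_def open_segment_def)
  obtain p q where pq: "p \<in> verts G" "F p = u" "q \<in> verts G" "F q = v"
    using onto uv' by (metis imageE)
  have "A = verts G"
  proof (rule adjacency_closed_eq_verts[OF G])
    show "A \<noteq> {}" using pq \<open>u \<in> S\<close> by (auto simp: A_def path_component_refl_eq)
  next
    fix r s assume rs: "adjacent G r s" "r \<in> A"
    have s: "s \<in> verts G" using placed_edge[OF G(1)] rs(1) by (auto simp: adjacent_def)
    have r: "path_component S u (F r)" using rs by (simp add: A_def)
    show "s \<in> A"
    proof (cases "F r = F s")
      case True
      then show ?thesis using r s by (simp add: A_def)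
    next
      case False
      then have adj: "adjacent H (F r) (F s)"
        using map rs(1) by (auto simp: simplicial_map_def)
      have "{F r, F s} \<noteq> {u, v}"
        using no[of r s] no[of s r] rs(1) by (auto simp: doubleton_eq_iff adjacent_def insert_commute)
      from seg[OF adj this] have "path_component S (F r) (F s)"
        unfolding path_component_def by (intro exI[of _ "linepath (F r) (F s)"]) auto
      then show ?thesis using r s by (auto simp: A_def intro: path_component_trans)
    qed
  qed (auto simp: A_def)
  then have "path_component S u v" using pq by (auto simp: A_def)
  then show False using tree_edge_separates[OF H uv] by (simp add: S_def)
qed

section \<open>Towers of trees\<close>

lemma comp_range_same: "comp_range g i i = id"
  by (simp add: comp_range_def)

lemma comp_range_Suc: "i \<le> j \<Longrightarrow> comp_range g i (Suc j) = comp_range g i j \<circ> g j"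
proof -
  have "foldr (\<circ>) xs h = foldr (\<circ>) xs id \<circ> h" for xs :: "(point \<Rightarrow> point) list" and h
    by (induction xs) (auto simp: comp_assoc)
  then show "i \<le> j \<Longrightarrow> ?thesis" by (simp add: comp_range_def)
qed

lemma comp_range_comp:
  assumes "i \<le> j" "j \<le> k"
  shows "comp_range g i k = comp_range g i j \<circ> comp_range g j k"
  using assms(2)
proof (induction k rule: dec_induct)
  case (step k)
  then show ?case using assms(1) by (simp add: comp_range_Suc comp_assoc)
qed (simp add: comp_range_same)

locale tree_tower =
  fixes l :: nat and T :: "nat \<Rightarrow> sgraph" and f g :: "nat \<Rightarrow> point \<Rightarrow> point" and \<epsilon> :: "nat \<Rightarrow> real"
  assumes tree: "n \<le> l \<Longrightarrow> simplicial_tree (T n)"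
    and f_map: "n < l \<Longrightarrow> simplicial_map (T (Suc n)) (T n) (f n)"
    and g_surj: "n < l \<Longrightarrow> simplicial_surjection (T (Suc n)) (T n) (g n)"
    and commute: "Suc n < l \<Longrightarrow> v \<in> verts (T (Suc (Suc n))) \<Longrightarrow> f n (g (Suc n) v) = g n (f (Suc n) v)"
    and no_proximity: "\<not> proximity_vertex (T 1) (T 0) (f 0) (g 0) v"
    and eps_0: "\<epsilon> 0 < 1" and eps_Suc: "n < l \<Longrightarrow> \<epsilon> (Suc n) < \<epsilon> n" and eps_l: "1 / 2 < \<epsilon> l"
begin

abbreviation "G \<equiv> comp_range g"
abbreviation "X \<equiv> realization (T l)"
abbreviation "U \<equiv> cover_elem T g \<epsilon> l"
abbreviation "cl A \<equiv> (top_of_set X) closure_of A"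
abbreviation "mass n v \<equiv> fibre_mass (T l) (G n l) v"

lemma placed: "n \<le> l \<Longrightarrow> placed_sgraph (T n)"
  using tree by (auto simp: simplicial_tree_def)

lemma eps_less: "n < j \<Longrightarrow> j \<le> l \<Longrightarrow> \<epsilon> j < \<epsilon> n"
proof (induction j)
  case (Suc j)
  then show ?case using eps_Suc[of j] by (cases "n = j") auto
qed simp

lemma eps_bounds: "n \<le> l \<Longrightarrow> 1 / 2 < \<epsilon> n \<and> \<epsilon> n < 1"
  using eps_less[of n l] eps_less[of 0 n] eps_0 eps_l by (cases "n = l"; cases "n = 0") auto

lemma G_surj: "n \<le> j \<Longrightarrow> j \<le> l \<Longrightarrow> simplicial_surjection (T j) (T n) (G n j)"
proof (induction j rule: dec_induct)
  case base
  show ?case unfolding comp_range_same by (rule simplicial_surjection_id)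
next
  case (step j)
  then have "simplicial_surjection (T j) (T n) (G n j)" "j < l" by auto
  then show ?case
    unfolding comp_range_Suc[OF step.hyps(1)]
    using simplicial_surjection_comp[OF g_surj] by blast
qed

lemma G_map: "n \<le> j \<Longrightarrow> j \<le> l \<Longrightarrow> simplicial_map (T j) (T n) (G n j)"
  using G_surj by (simp add: simplicial_surjection_def)

lemma G_in: "n \<le> j \<Longrightarrow> j \<le> l \<Longrightarrow> v \<in> verts (T j) \<Longrightarrow> G n j v \<in> verts (T n)"
  using G_map[of n j] by (auto simp: simplicial_map_def)

lemma G_preimage:
  assumes "n \<le> l" "v \<in> verts (T n)"
  obtains w where "w \<in> verts (T l)" "G n l w = v"
  using G_surj[OF assms(1) order_refl] assms(2) unfolding simplicial_surjection_def by (metis imageE)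

lemma f_in: "n < l \<Longrightarrow> v \<in> verts (T (Suc n)) \<Longrightarrow> f n v \<in> verts (T n)"
  using f_map[of n] by (auto simp: simplicial_map_def)

lemma G_G: "i \<le> j \<Longrightarrow> j \<le> k \<Longrightarrow> G i j (G j k w) = G i k w"
  by (simp add: comp_range_comp[of i j k])

lemma G_f:
  assumes "n \<le> j"
  shows "j < l \<Longrightarrow> v \<in> verts (T (Suc j)) \<Longrightarrow> G n j (f j v) = f n (G (Suc n) (Suc j) v)"
  using assms
proof (induction j arbitrary: v rule: dec_induct)
  case base
  then show ?case by (simp add: comp_range_same)
next
  case (step j)
  have "g (Suc j) v \<in> verts (T (Suc j))"
    using g_surj[of "Suc j"] step.prems by (auto simp: simplicial_surjection_def)
  with step.prems step.IH[of "g (Suc j) v"] step.hyps commute[of j v] show ?case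
    by (simp add: comp_range_Suc)
qed

text \<open>Applying \<open>G 0 n\<close> to \<open>f n v\<close> and \<open>g n v\<close> yields \<open>f 0 w\<close> and \<open>g 0 w\<close> for one and the same vertex
  \<open>w = G 1 (Suc n) v\<close>, which would be a proximity vertex.\<close>

lemma not_2_close:
  assumes "n < l" "v \<in> verts (T (Suc n))"
  shows "\<not> k_close (T n) 2 (f n v) (g n v)"
proof
  assume "k_close (T n) 2 (f n v) (g n v)"
  then have close: "k_close (T 0) 2 (G 0 n (f n v)) (G 0 n (g n v))"
    using k_close_image[OF G_map[of 0 n]] assms by simp
  define w where "w = G 1 (Suc n) v"
  have "G 0 n (f n v) = f 0 w" using G_f[of 0 n v] assms by (simp add: w_def)
  moreover have "G 0 n (g n v) = g 0 w"
    using G_G[of 0 n "Suc n" v] G_G[of 0 1 "Suc n" v]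
    by (simp add: w_def comp_range_Suc comp_range_same)
  moreover have "w \<in> verts (T 1)" using G_in[of 1 "Suc n" v] assms by (simp add: w_def)
  ultimately show False using close no_proximity[of w] by (simp add: proximity_vertex_def)
qed

section \<open>Covers by preimages of stars\<close>

lemma U_eq:
  assumes "n \<le> l" "v \<in> verts (T n)"
  shows "U n v = {x \<in> X. 1 - \<epsilon> n < mass n v x}"
  using preimage_star_eq[OF placed[OF order_refl] placed[OF assms(1)] G_map[OF assms(1) order_refl]
      assms(2)] eps_bounds[OF assms(1)]
  by (auto simp: cover_elem_def)

lemma cl_U_subset:
  assumes "n \<le> l" "v \<in> verts (T n)"
  shows "cl (U n v) \<subseteq> {x \<in> X. 1 - \<epsilon> n \<le> mass n v x}"
proof (rule closure_of_minimal)
  have "closedin (top_of_set X) (X \<inter> mass n v -` {1 - \<epsilon> n..})"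
    by (intro continuous_closedin_preimage continuous_on_fibre_mass placed) auto
  then show "closedin (top_of_set X) {x \<in> X. 1 - \<epsilon> n \<le> mass n v x}"
    by (simp add: vimage_def Collect_conj_eq)
qed (auto simp: U_eq[OF assms])

lemma U_subset_cl: "U n v \<subseteq> cl (U n v)"
  by (rule closure_of_subset) (auto simp: cover_elem_def)

lemma openin_U:
  assumes "n \<le> l" "v \<in> verts (T n)"
  shows "openin (top_of_set X) (U n v)"
proof -
  have "openin (top_of_set X) (X \<inter> mass n v -` {1 - \<epsilon> n<..})"
    by (intro continuous_openin_preimage_gen continuous_on_fibre_mass placed) auto
  then show ?thesis by (simp add: U_eq[OF assms] vimage_def Collect_conj_eq)
qed

text \<open>On the closure the weight over \<open>w\<close> is at least \<open>1 - \<epsilon> j\<close>; the fibre over \<open>G n j w\<close> is larger, and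
  \<open>1 - \<epsilon> j\<close> already exceeds the threshold \<open>1 - \<epsilon> n\<close>.\<close>

lemma cl_U_subset_U:
  assumes "n < j" "j \<le> l" "w \<in> verts (T j)"
  shows "cl (U j w) \<subseteq> U n (G n j w)"
proof
  fix x assume "x \<in> cl (U j w)"
  then have x: "x \<in> X" "1 - \<epsilon> j \<le> mass j w x" using cl_U_subset assms by auto
  have "mass j w x \<le> mass n (G n j w) x"
    using fibre_mass_compose_le[OF placed[OF order_refl] x(1), of "G j l" w "G n j"] assms
    by (simp add: comp_range_comp[of n j l])
  then show "x \<in> U n (G n j w)"
    using x eps_less[OF assms(1,2)] G_in[of n j w] assms by (simp add: U_eq)
qed

lemma vertex_in_U_iff:
  assumes "n \<le> l" "v \<in> verts (T n)" "w \<in> verts (T l)"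
  shows "w \<in> U n v \<longleftrightarrow> G n l w = v"
  using assms eps_bounds[OF assms(1)]
  by (auto simp: U_eq fibre_mass_vertex[OF placed[OF order_refl]] realization_def)

text \<open>A vertex of the top tree over \<open>v\<close> lies in no other element of the same level.\<close>

lemma inj_on_U: "n \<le> l \<Longrightarrow> inj_on (U n) (verts (T n))"
  by (rule inj_onI) (metis G_preimage vertex_in_U_iff)

lemma cover_map_U:
  assumes "n < l" "v \<in> verts (T (Suc n))"
  shows "cover_map T f g \<epsilon> l n (U (Suc n) v) = U n (f n v)"
proof -
  have "(THE w. w \<in> verts (T (Suc n)) \<and> U (Suc n) w = U (Suc n) v) = v"
    using assms inj_on_U[of "Suc n"] by (intro the_equality) (auto dest: inj_onD)
  then show ?thesis by (simp add: cover_map_def)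
qed

lemma position_charged:
  assumes "position (T l) x a b s" "0 < mass n v x"
  shows "\<exists>w\<in>{a, b}. G n l w = v"
  using assms by (force simp: fibre_mass_position[OF placed[OF order_refl] assms(1)] bary_def
      split: if_splits)

lemma cl_U_charged: "n \<le> l \<Longrightarrow> v \<in> verts (T n) \<Longrightarrow> x \<in> cl (U n v) \<Longrightarrow> x \<in> X \<and> 0 < mass n v x"
  using cl_U_subset[of n v] eps_bounds[of n] by fastforce

text \<open>A common point of the closures gives positive weight to a vertex over \<open>u\<close> and to one over \<open>v\<close>, and the
  only vertices with weight are the ends of the segment carrying the point.\<close>

lemma closures_meet_imp_linked:
  assumes "j \<le> l" "n \<le> l" "u \<in> verts (T j)" "v \<in> verts (T n)" "cl (U j u) \<inter> cl (U n v) \<noteq> {}"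
  obtains w z where "linked (T l) w z" "G j l w = u" "G n l z = v"
proof -
  obtain x where x: "x \<in> X" "0 < mass j u x" "0 < mass n v x"
    using assms cl_U_charged by blast
  obtain a b s where p: "position (T l) x a b s"
    using position_exists[OF placed[OF order_refl] x(1)] .
  obtain w z where wz: "w \<in> {a, b}" "z \<in> {a, b}" "G j l w = u" "G n l z = v"
    using position_charged[OF p x(2)] position_charged[OF p x(3)] by blast
  have "linked (T l) a b" using p by (simp add: position_def)
  then have "linked (T l) w z"
    using wz(1,2) linked_sym[of "T l" a b] by (auto simp: linked_def)
  then show thesis using that wz by blast
qed

text \<open>The midpoint has weight at least \<open>1 / 2\<close> over each of the two projected vertices, at whatever
  level, and every threshold \<open>1 - \<epsilon> n\<close> is below \<open>1 / 2\<close>.\<close>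

lemma linked_imp_meet:
  assumes "j \<le> l" "n \<le> l" "linked (T l) w z"
  shows "U j (G j l w) \<inter> U n (G n l z) \<noteq> {}"
proof -
  define x where "x = (1 - 1 / 2) *\<^sub>R w + (1 / 2) *\<^sub>R z"
  have p: "position (T l) x w z (1 / 2)" using assms(3) by (simp add: position_def x_def)
  have wz: "w \<in> verts (T l)" "z \<in> verts (T l)" using assms(3) by (auto simp: linked_def)
  have "1 / 2 \<le> mass j (G j l w) x" "1 / 2 \<le> mass n (G n l z) x"
    by (auto simp: fibre_mass_position[OF placed[OF order_refl] p] bary_def)
  then have "x \<in> U j (G j l w)" "x \<in> U n (G n l z)"
    using wz eps_bounds[OF assms(1)] eps_bounds[OF assms(2)] assms
      position_in_realization[OF placed[OF order_refl] p]
    by (auto simp: U_eq G_in)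
  then show ?thesis by blast
qed

lemma linked_lifts:
  assumes "n \<le> l" "linked (T n) u v"
  obtains w z where "linked (T l) w z" "G n l w = u" "G n l z = v"
proof (cases "u = v")
  case True
  then obtain w where "w \<in> verts (T l)" "G n l w = u"
    using assms G_preimage[of n u] by (auto simp: linked_def)
  then show thesis using that[of w w] True by (simp add: linked_refl)
next
  case False
  then have "adjacent (T n) u v" using assms by (simp add: linked_def)
  moreover have "connected X" using tree[of l] by (simp add: simplicial_tree_def tree_space_def)
  ultimately obtain p q where pq: "adjacent (T l) p q" "G n l p = u" "G n l q = v"
    using edge_lifts[OF placed[OF order_refl] _ tree[OF assms(1)] G_surj[OF assms(1) order_refl]]
    by blast
  then have "linked (T l) p q"
    using placed_edge[OF placed[OF order_refl]] by (auto simp: linked_def adjacent_def)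
  then show thesis using that pq by blast
qed

lemma meet_imp_linked:
  assumes "j \<le> l" "n \<le> j" "u \<in> verts (T j)" "v \<in> verts (T n)" "U j u \<inter> U n v \<noteq> {}"
  shows "linked (T n) (G n j u) v"
proof -
  have "cl (U j u) \<inter> cl (U n v) \<noteq> {}" using assms(5) U_subset_cl by blast
  then obtain w z where wz: "linked (T l) w z" "G j l w = u" "G n l z = v"
    using closures_meet_imp_linked[of j n u v] assms by auto
  then show ?thesis
    using linked_image[OF G_map[of n l] wz(1)] G_G[of n j l w] assms by simp
qed

lemma same_level_meet_iff:
  assumes "n \<le> l" "u \<in> verts (T n)" "v \<in> verts (T n)"
  shows "U n u \<inter> U n v \<noteq> {} \<longleftrightarrow> linked (T n) u v"
proof
  assume "linked (T n) u v"
  then show "U n u \<inter> U n v \<noteq> {}"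
    using linked_lifts[OF assms(1)] linked_imp_meet[OF assms(1,1)] by metis
qed (use meet_imp_linked[of n n u v] assms in \<open>simp add: comp_range_same\<close>)

lemma intersections:
  assumes "j \<le> l" "n \<le> j" "u \<in> verts (T j)" "v \<in> verts (T n)"
  defines "c \<equiv> \<exists>w\<in>verts (T l). \<exists>z\<in>verts (T l). G j l w = u \<and> G n l z = v \<and> linked (T l) w z"
  shows "U j u \<inter> U n v \<noteq> {} \<longleftrightarrow> cl (U j u) \<inter> cl (U n v) \<noteq> {}"
    and "cl (U j u) \<inter> cl (U n v) \<noteq> {} \<longleftrightarrow> c"
proof -
  have ab: "U j u \<inter> U n v \<noteq> {} \<Longrightarrow> cl (U j u) \<inter> cl (U n v) \<noteq> {}"
    using U_subset_cl by blast
  have bc: "cl (U j u) \<inter> cl (U n v) \<noteq> {} \<Longrightarrow> c"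
    using closures_meet_imp_linked[of j n u v] assms unfolding c_def linked_def
    by (metis order_trans)
  have ca: "c \<Longrightarrow> U j u \<inter> U n v \<noteq> {}"
    using linked_imp_meet[of j n] assms unfolding c_def by (metis order_trans)
  show "U j u \<inter> U n v \<noteq> {} \<longleftrightarrow> cl (U j u) \<inter> cl (U n v) \<noteq> {}"
    and "cl (U j u) \<inter> cl (U n v) \<noteq> {} \<longleftrightarrow> c" using ab bc ca by blast+
qed

lemma U_point_two_vertices:
  assumes "n \<le> l" "x \<in> X"
  obtains a b where "\<And>v. v \<in> verts (T n) \<Longrightarrow> x \<in> U n v \<Longrightarrow> v \<in> {a, b}"
proof -
  obtain a b s where p: "position (T l) x a b s"
    using position_exists[OF placed[OF order_refl] assms(2)] .
  have "v \<in> {G n l a, G n l b}" if "v \<in> verts (T n)" "x \<in> U n v" for v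
    using position_charged[OF p, of n v] cl_U_charged[of n v x] U_subset_cl[of n v] that assms
    by blast
  then show thesis by (rule that)
qed

lemma triple_intersection_empty:
  assumes "n \<le> l" "u \<in> verts (T n)" "v \<in> verts (T n)" "w \<in> verts (T n)" "u \<noteq> v" "u \<noteq> w" "v \<noteq> w"
  shows "U n u \<inter> U n v \<inter> U n w = {}"
proof (rule equals0I)
  fix x assume x: "x \<in> U n u \<inter> U n v \<inter> U n w"
  then have "x \<in> X" by (simp add: cover_elem_def)
  then obtain a b where "\<And>v. v \<in> verts (T n) \<Longrightarrow> x \<in> U n v \<Longrightarrow> v \<in> {a, b}"
    using U_point_two_vertices[OF assms(1)] by blast
  then have "u \<in> {a, b}" "v \<in> {a, b}" "w \<in> {a, b}" using x assms by auto
  then show False using assms by auto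
qed

text \<open>One endpoint of the segment carrying a point has weight at least \<open>1 / 2\<close>.\<close>

lemma open_cover_U:
  assumes "n \<le> l"
  shows "open_cover X (cover_family T g \<epsilon> l n)"
proof -
  have "\<exists>v\<in>verts (T n). x \<in> U n v" if x: "x \<in> X" for x
  proof -
    obtain a b s where p: "position (T l) x a b s"
      using position_exists[OF placed[OF order_refl] x] .
    have s: "0 \<le> s" "s \<le> 1" and "a \<in> verts (T l)" "b \<in> verts (T l)"
      using p by (auto simp: position_def linked_def)
    then have ab: "G n l a \<in> verts (T n)" "G n l b \<in> verts (T n)"
      using G_in[OF assms order_refl] by auto
    have "1 / 2 \<le> mass n (G n l a) x \<or> 1 / 2 \<le> mass n (G n l b) x"
      using s by (auto simp: fibre_mass_position[OF placed[OF order_refl] p] bary_def)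
    then have "x \<in> U n (G n l a) \<or> x \<in> U n (G n l b)"
      using eps_bounds[OF assms] x by (auto simp: U_eq[OF assms ab(1)] U_eq[OF assms ab(2)])
    then show ?thesis using ab by blast
  qed
  then show ?thesis
    using openin_U[OF assms] by (auto simp: open_cover_def cover_family_def cover_elem_def)
qed

lemma Inter_U_nonempty_iff:
  assumes n: "n \<le> l" and A: "A \<subseteq> verts (T n)" "A \<noteq> {}"
  shows "\<Inter>(U n ` A) \<noteq> {} \<longleftrightarrow> A \<in> graph_complex (T n)"
proof
  assume "\<Inter>(U n ` A) \<noteq> {}"
  then obtain x where x: "x \<in> \<Inter>(U n ` A)" by blast
  obtain u where u: "u \<in> A" using A by blast
  have "x \<in> X" using x u by (auto simp: cover_elem_def)
  then obtain a b where ab: "\<And>v. v \<in> verts (T n) \<Longrightarrow> x \<in> U n v \<Longrightarrow> v \<in> {a, b}"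
    using U_point_two_vertices[OF n] by blast
  have sub: "A \<subseteq> {a, b}" using ab A x by blast
  show "A \<in> graph_complex (T n)"
  proof (cases "A = {u}")
    case True
    then show ?thesis using A by (auto simp: graph_complex_def)
  next
    case False
    then obtain v where v: "v \<in> A" "v \<noteq> u" using u by blast
    then have "A = {u, v}" using sub u by blast
    moreover have "linked (T n) u v"
      using same_level_meet_iff[OF n, of u v] u v x A by blast
    ultimately show ?thesis using v by (simp add: graph_complex_def linked_def adjacent_def)
  qed
next
  assume "A \<in> graph_complex (T n)"
  then consider v where "A = {v}" | "A \<in> edges (T n)" by (auto simp: graph_complex_def)
  then obtain u v where uv: "A = {u, v}" "linked (T n) u v"
  proof cases
    case (1 v)
    then show thesis using that[of v v] A by (simp add: linked_refl)
  next
    case 2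
    then obtain u v where "A = {u, v}" by (rule placed_edgeE[OF placed[OF n]])
    then show thesis using that[of u v] A 2 by (simp add: linked_def adjacent_def)
  qed
  then have "U n u \<inter> U n v \<noteq> {}" using same_level_meet_iff[OF n, of u v] A by blast
  then show "\<Inter>(U n ` A) \<noteq> {}" using uv by simp
qed

lemma nerve_isomorphism:
  assumes n: "n \<le> l"
  defines "\<U> \<equiv> cover_family T g \<epsilon> l n"
  shows "\<exists>h. (\<forall>u\<in>verts (T n). h (U n u) = u) \<and>
    complex_isomorphism \<U> (nerve \<U>) (verts (T n)) (graph_complex (T n)) h"
proof (intro exI conjI ballI)
  let ?h = "inv_into (verts (T n)) (U n)"
  note inj = inj_on_U[OF n]
  show h: "?h (U n u) = u" if "u \<in> verts (T n)" for u
    using inv_into_f_f[OF inj that] .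
  show "complex_isomorphism \<U> (nerve \<U>) (verts (T n)) (graph_complex (T n)) ?h"
    unfolding complex_isomorphism_def
  proof (intro conjI allI impI)
    show "bij_betw ?h \<U> (verts (T n))"
      unfolding \<U>_def cover_family_def using inj by (intro bij_betw_inv_into) (simp add: bij_betw_def)
  next
    fix S assume "S \<subseteq> \<U>"
    then obtain A where A: "A \<subseteq> verts (T n)" "S = U n ` A"
      unfolding \<U>_def cover_family_def by (metis subset_image_iff)
    have img: "?h ` S = A" using A h by (force simp: image_image)
    have "finite A" using A placed[OF n] finite_subset by (auto simp: placed_sgraph_def)
    show "S \<in> nerve \<U> \<longleftrightarrow> ?h ` S \<in> graph_complex (T n)"
    proof (cases "A = {}")
      case True
      have "{} \<notin> edges (T n)" using placed_edgeE[OF placed[OF n]] by blast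
      then show ?thesis using True A by (auto simp: nerve_def graph_complex_def)
    next
      case False
      then show ?thesis
        unfolding img using Inter_U_nonempty_iff[OF n A(1)] \<open>S \<subseteq> \<U>\<close> A(2) \<open>finite A\<close>
        by (simp add: nerve_def)
    qed
  qed
qed

section \<open>The action of the simplicial maps on the covers\<close>

lemma f_moves_away:
  assumes "n < l" "u \<in> verts (T n)" "v \<in> verts (T (Suc n))" "U n u \<inter> U (Suc n) v \<noteq> {}"
  shows "U n (f n v) \<inter> U n u = {}"
proof (rule ccontr)
  assume "U n (f n v) \<inter> U n u \<noteq> {}"
  then have "linked (T n) (f n v) u"
    using same_level_meet_iff[of n "f n v" u] f_in assms by simp
  moreover have "linked (T n) u (g n v)"
    using meet_imp_linked[of "Suc n" n v u] assms
    by (auto simp: comp_range_Suc comp_range_same Int_commute intro: linked_sym)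
  ultimately show False
    using not_2_close[OF assms(1,3)] linked_trans_k_close_2 by blast
qed

text \<open>Meeting yields linked top vertices \<open>w\<close> over \<open>u\<close> and \<open>z\<close> over \<open>v\<close>. The map \<open>f j\<close> acts only at level
  \<open>Suc j\<close>, so the pair is pushed down to that level, moved by \<open>f j\<close> to level \<open>j\<close>, and lifted to the top again
  along the tree \<open>T j\<close>; commutation shows that the second lifted vertex lies over \<open>f n v\<close>.\<close>

lemma f_preserves_meeting:
  assumes "j < l" "n \<le> j" "u \<in> verts (T (Suc j))" "v \<in> verts (T (Suc n))"
    and meet: "U (Suc j) u \<inter> U (Suc n) v \<noteq> {}"
  shows "U j (f j u) \<inter> U n (f n v) \<noteq> {}"
proof -
  have "cl (U (Suc j) u) \<inter> cl (U (Suc n) v) \<noteq> {}" using meet U_subset_cl by blast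
  then obtain w z where wz: "linked (T l) w z" "G (Suc j) l w = u" "G (Suc n) l z = v"
    using closures_meet_imp_linked[of "Suc j" "Suc n" u v] assms by auto
  define u' where "u' = G (Suc j) l z"
  have u': "linked (T (Suc j)) u u'"
    using linked_image[OF G_map[of "Suc j" l] wz(1)] assms wz by (simp add: u'_def)
  have "linked (T j) (f j u) (f j u')" using linked_image[OF f_map u'] assms by simp
  then obtain p q where pq: "linked (T l) p q" "G j l p = f j u" "G j l q = f j u'"
    using linked_lifts[of j] assms by (metis less_imp_le)
  have "G n l q = G n j (f j u')" using G_G[of n j l q] pq assms by simp
  also have "\<dots> = f n (G (Suc n) (Suc j) u')"
    using G_f[of n j u'] u' assms by (simp add: linked_def)
  also have "G (Suc n) (Suc j) u' = v"
    using G_G[of "Suc n" "Suc j" l z] wz assms by (simp add: u'_def)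
  finally show ?thesis using linked_imp_meet[of j n p q] pq assms by simp
qed

text \<open>A top vertex over \<open>u\<close> lies in both elements, so the inclusion forces \<open>v\<close> to be the projection of \<open>u\<close>.
  By commutation \<open>f n v\<close> is then the projection of \<open>f j u\<close>, and closures of higher elements lie in the elements of
  their projections.\<close>

lemma f_preserves_inclusion:
  assumes "j < l" "n < j" "u \<in> verts (T (Suc j))" "v \<in> verts (T (Suc n))"
    and sub: "U (Suc j) u \<subseteq> U (Suc n) v"
  shows "cl (U j (f j u)) \<subseteq> U n (f n v)"
proof -
  obtain w where w: "w \<in> verts (T l)" "G (Suc j) l w = u" using G_preimage[of "Suc j" u] assms by auto
  then have "w \<in> U (Suc n) v" using vertex_in_U_iff[of "Suc j" u w] sub assms by auto
  then have "G (Suc n) (Suc j) u = v"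
    using vertex_in_U_iff[of "Suc n" v w] w G_G[of "Suc n" "Suc j" l w] assms by simp
  then have "G n j (f j u) = f n v" using G_f[of n j u] assms by simp
  then show ?thesis using cl_U_subset_U[of n j "f j u"] f_in assms by simp
qed

end

theorem theorem6p5:
  fixes l :: nat
    and T :: "nat \<Rightarrow> sgraph"
    and f g :: "nat \<Rightarrow> point \<Rightarrow> point"
    and \<epsilon> :: "nat \<Rightarrow> real"
    and G :: "nat \<Rightarrow> nat \<Rightarrow> point \<Rightarrow> point"
    and X :: "point set"
    and cl :: "point set \<Rightarrow> point set"
    and U :: "nat \<Rightarrow> point \<Rightarrow> point set"
    and \<U> :: "nat \<Rightarrow> point set set"
    and \<phi> :: "nat \<Rightarrow> point set \<Rightarrow> point set"
  defines "G \<equiv> comp_range g"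
    and "X \<equiv> realization (T l)"
    and "cl \<equiv> (\<lambda>A. (top_of_set X) closure_of A)"
    and "U \<equiv> cover_elem T g \<epsilon> l"
    and "\<U> \<equiv> cover_family T g \<epsilon> l"
    and "\<phi> \<equiv> cover_map T f g \<epsilon> l"
  assumes "l > 0"
    and "\<forall>n\<le>l. simplicial_tree (T n)"
    and "\<forall>n<l. simplicial_map (T (n + 1)) (T n) (f n)"
    and "\<forall>n<l. simplicial_surjection (T (n + 1)) (T n) (g n)"
    and "\<forall>i\<in>{1..l - 1}. \<forall>v\<in>verts (T (i + 1)). f (i - 1) (g i v) = g (i - 1) (f i v)"
    and "\<not> (\<exists>v. proximity_vertex (T 1) (T 0) (f 0) (g 0) v)"
    and "1 > \<epsilon> 0" and "\<forall>n<l. \<epsilon> n > \<epsilon> (n + 1)" and "\<epsilon> l > 1 / 2"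
  shows
   "(\<comment> \<open>the maps \<open>\<phi> n\<close> are well defined\<close>
     \<forall>n<l. \<forall>v\<in>verts (T (n + 1)). \<phi> n (U (n + 1) v) = U n (f n v)) \<and>
    (\<comment> \<open>(1)\<close>
     \<forall>j\<in>{1..l}. \<forall>n\<in>{0..j - 1}. \<forall>w\<in>verts (T j). cl (U j w) \<subseteq> U n (G n j w)) \<and>
    (\<comment> \<open>(2)\<close>
     \<forall>n\<le>l. \<forall>v\<in>verts (T n). \<forall>w\<in>verts (T l). w \<in> U n v \<longleftrightarrow> G n l w = v) \<and>
    (\<comment> \<open>(3)\<close>
     \<forall>j\<le>l. \<forall>n\<le>j. \<forall>u\<in>verts (T j). \<forall>v\<in>verts (T n).
       let a = (U j u \<inter> U n v \<noteq> {});
           b = (cl (U j u) \<inter> cl (U n v) \<noteq> {});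
           c = (\<exists>w\<in>verts (T l). \<exists>z\<in>verts (T l). G j l w = u \<and> G n l z = v \<and> k_close (T l) 1 w z);
           d = k_close (T n) 1 (G n j u) v
       in (a \<longleftrightarrow> b) \<and> (b \<longleftrightarrow> c) \<and> (a \<longrightarrow> d) \<and> (j = n \<longrightarrow> (a \<longleftrightarrow> d))) \<and>
    (\<comment> \<open>(4)\<close>
     \<forall>n\<le>l. \<forall>u\<in>verts (T n). \<forall>v\<in>verts (T n). \<forall>w\<in>verts (T n).
       u \<noteq> v \<and> u \<noteq> w \<and> v \<noteq> w \<longrightarrow> U n u \<inter> U n v \<inter> U n w = {}) \<and>
    (\<comment> \<open>(5)\<close>
     \<forall>n\<le>l. open_cover X (\<U> n) \<and>
       (\<exists>h. (\<forall>u\<in>verts (T n). h (U n u) = u) \<and>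
            complex_isomorphism (\<U> n) (nerve (\<U> n)) (verts (T n)) (graph_complex (T n)) h)) \<and>
    (\<comment> \<open>(6)\<close>
     \<forall>n<l. \<forall>u\<in>verts (T n). \<forall>v\<in>verts (T (n + 1)).
       U n u \<inter> U (n + 1) v \<noteq> {} \<longrightarrow> \<phi> n (U (n + 1) v) \<inter> U n u = {}) \<and>
    (\<comment> \<open>(7); in the second implication \<open>n < j\<close>, since for \<open>n = j\<close> and \<open>u = v\<close> it would make
        a nonempty proper open subset of the continuum \<open>X\<close> closed\<close>
     \<forall>j\<in>{2..l - 1}. \<forall>n\<in>{1..j}. \<forall>u\<in>verts (T (j + 1)). \<forall>v\<in>verts (T (n + 1)).
       (U (j + 1) u \<inter> U (n + 1) v \<noteq> {} \<longrightarrow> \<phi> j (U (j + 1) u) \<inter> \<phi> n (U (n + 1) v) \<noteq> {}) \<and>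
       (n < j \<longrightarrow> U (j + 1) u \<subseteq> U (n + 1) v \<longrightarrow> cl (\<phi> j (U (j + 1) u)) \<subseteq> \<phi> n (U (n + 1) v))) \<and>
    (\<comment> \<open>(8)\<close>
     \<forall>n<l. \<forall>u\<in>verts (T (n + 1)). \<forall>v\<in>verts (T (n + 1)).
       U (n + 1) u \<inter> U (n + 1) v \<noteq> {} \<longrightarrow> \<phi> n (U (n + 1) u) \<inter> \<phi> n (U (n + 1) v) \<noteq> {})"
proof -
  interpret tree_tower l T f g \<epsilon>
  proof
    fix n v assume "Suc n < l" "v \<in> verts (T (Suc (Suc n)))"
    then show "f n (g (Suc n) v) = g n (f (Suc n) v)"
      using assms(11) by (auto dest!: bspec[of _ _ "Suc n"])
  qed (use assms in auto)
  have \<phi>_U: "\<phi> n (U (Suc n) v) = U n (f n v)" if "n < l" "v \<in> verts (T (Suc n))" for n v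
    unfolding \<phi>_def U_def using that by (rule cover_map_U)
  have four_conditions: "let a = (U j u \<inter> U n v \<noteq> {});
           b = (cl (U j u) \<inter> cl (U n v) \<noteq> {});
           c = (\<exists>w\<in>verts (T l). \<exists>z\<in>verts (T l). G j l w = u \<and> G n l z = v \<and> k_close (T l) 1 w z);
           d = k_close (T n) 1 (G n j u) v
       in (a \<longleftrightarrow> b) \<and> (b \<longleftrightarrow> c) \<and> (a \<longrightarrow> d) \<and> (j = n \<longrightarrow> (a \<longleftrightarrow> d))"
    if "j \<le> l" "n \<le> j" "u \<in> verts (T j)" "v \<in> verts (T n)" for j n u v
    unfolding Let_def k_close_1_iff G_def X_def cl_def U_def
  proof (intro conjI impI, goal_cases)
    case 4
    then show ?case
      using same_level_meet_iff[of n u v] that by (simp add: comp_range_same)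
  qed (use intersections[OF that] meet_imp_linked[OF that] in blast)+
  have meeting: "\<phi> j (U (Suc j) u) \<inter> \<phi> n (U (Suc n) v) \<noteq> {}"
    if "j < l" "n \<le> j" "u \<in> verts (T (Suc j))" "v \<in> verts (T (Suc n))"
      "U (Suc j) u \<inter> U (Suc n) v \<noteq> {}" for j n u v
    using f_preserves_meeting[of j n u v] that by (simp add: \<phi>_U) (simp add: U_def)
  have inclusion: "cl (\<phi> j (U (Suc j) u)) \<subseteq> \<phi> n (U (Suc n) v)"
    if "j < l" "n < j" "u \<in> verts (T (Suc j))" "v \<in> verts (T (Suc n))"
      "U (Suc j) u \<subseteq> U (Suc n) v" for j n u v
    using f_preserves_inclusion[of j n u v] that
    by (simp add: \<phi>_U) (simp add: U_def cl_def X_def)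
  show ?thesis
    apply (intro conjI allI impI ballI)
    subgoal using \<phi>_U by simp
    subgoal for j n w unfolding cl_def U_def G_def X_def by (rule cl_U_subset_U) auto
    subgoal unfolding U_def G_def by (rule vertex_in_U_iff)
    subgoal by (rule four_conditions)
    subgoal unfolding U_def by (elim conjE) (rule triple_intersection_empty)
    subgoal unfolding X_def \<U>_def by (rule open_cover_U)
    subgoal unfolding U_def \<U>_def by (rule nerve_isomorphism)
    subgoal using f_moves_away by (simp add: \<phi>_U) (simp add: U_def)
    subgoal premises p for j n u v
    proof -
      have "j < l" using p(1) by auto
      then show ?thesis using meeting[of j n u v] p by simp
    qed
    subgoal premises p for j n u v
    proof -
      have "j < l" using p(1) by auto
      then show ?thesis using inclusion[of j n u v] p by simp
    qed
    subgoal for n u v using meeting[of n n u v] by simp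
    done
qed

end
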